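(* Let $(M, \mathcal G)$ be a general model, let $X \in \mathcal G$ and let $\phi$ be an independence logic formula over the signature of $M$ with $\mathrm{Free}(\phi) = \bar z \subseteq \mathrm{Dom}(X)$. Then $(M, \mathcal G) \models_X \phi$ if and only if $(M, \mathcal G) \models_{X_{|\bar z}} \phi$, where $X_{|\bar z}=\{s_{|\bar z}:s\in X\}$.
   Context: A team over $M$ with domain $V$ (finite) is a set of assignments $V\to\mathrm{Dom}(M)$. $\mathrm{Rel}(X)=\{s(\bar z):s\in X\}$. A general model $(M,\mathcal G)$ is a first-order structure $M$ together with a set $\mathcal G$ of teams over finite domains. It is required that for every first-order formula $\phi(x_1\ldots x_n,\bar m,\bar R)$ with element parameters $\bar m$ and relation parameters $R_i=\mathrm{Rel}(X_i)$, $X_i\in\mathcal G$, the team $\|\phi\|_M=\{s:\mathrm{Dom}(s)=\{x_1\ldots x_n\},M\models_s\phi\}$ belongs to $\mathcal G$. Independence logic formulas are in negation normal form, built from first-order literals, independence atoms $\bar t_2\perp_{\bar t_1}\bar t_3$, $\wedge,\vee,\exists,\forall$. For $X\in\mathcal G$, $(M,\mathcal G)\models_X\phi$ is defined by: - literal: each $s\in X$ satisfies it; - $\bar t_2\perp_{\bar t_1}\bar t_3$: for all $s,s'\in X$ with $\bar t_1\langle s\rangle=\bar t_1\langle s'\rangle$ there is $s''\in X$ with $\bar t_1\bar t_2\langle s''\rangle=\bar t_1\bar t_2\langle s\rangle$ and $\bar t_1\bar t_3\langle s''\rangle=\bar t_1\bar t_3\langle s'\rangle$; - $\psi_1\vee\psi_2$: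 $X=Y\cup Z$ for some $Y,Z\in\mathcal G$ with $(M,\mathcal G)\models_Y\psi_1$ and $(M,\mathcal G)\models_Z\psi_2$; - $\psi_1\wedge\psi_2$: both hold in $X$; - $\exists x\psi$: there is $X'\in\mathcal G$ with $\mathrm{Dom}(X')=\mathrm{Dom}(X)\cup\{x\}$, whose restriction to $\mathrm{Dom}(X)\setminus\{x\}$ equals that of $X$, such that $(M,\mathcal G)\models_{X'}\psi$; - $\forall x\psi$: $(M,\mathcal G)\models_{X[M/x]}\psi$ with $X[M/x]=\{s[m/x]:s\in X,m\in\mathrm{Dom}(M)\}$. *)

theory Defs
  imports Main
begin

section \<open>First-order structures and formulas\<close>

type_synonym var = nat

datatype 'f trm = Var var | Fn 'f "'f trm list"

fun trm_vars :: "'f trm \<Rightarrow> var set" where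
  "trm_vars (Var x) = {x}"
| "trm_vars (Fn f ts) = (\<Union>t\<in>set ts. trm_vars t)"

datatype ('f, 'r) atm = Eq "'f trm" "'f trm" | Rl 'r "'f trm list"

primrec atm_vars :: "('f, 'r) atm \<Rightarrow> var set" where
  "atm_vars (Eq t u) = trm_vars t \<union> trm_vars u"
| "atm_vars (Rl r ts) = (\<Union>t\<in>set ts. trm_vars t)"

text \<open>The signature is part of the structure: a symbol belongs to it iff its arity is defined.
  The values of the interpretations on symbols outside the signature, or on argument lists of the
  wrong length or outside the domain, are irrelevant.\<close>

record ('a, 'f, 'r) fo_struct =
  Dom :: "'a set"
  fun_arity :: "'f \<rightharpoonup> nat"
  rel_arity :: "'r \<rightharpoonup> nat"
  fun_int :: "'f \<Rightarrow> 'a list \<Rightarrow> 'a"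
  rel_int :: "'r \<Rightarrow> 'a list set"

definition is_structure :: "('a, 'f, 'r) fo_struct \<Rightarrow> bool" where
  "is_structure M \<longleftrightarrow> Dom M \<noteq> {} \<and>
     (\<forall>f as. fun_arity M f = Some (length as) \<and> set as \<subseteq> Dom M \<longrightarrow> fun_int M f as \<in> Dom M)"

fun wf_trm :: "('a, 'f, 'r) fo_struct \<Rightarrow> 'f trm \<Rightarrow> bool" where
  "wf_trm M (Var x) \<longleftrightarrow> True"
| "wf_trm M (Fn f ts) \<longleftrightarrow> fun_arity M f = Some (length ts) \<and> (\<forall>t\<in>set ts. wf_trm M t)"

primrec wf_atm :: "('a, 'f, 'r) fo_struct \<Rightarrow> ('f, 'r) atm \<Rightarrow> bool" where
  "wf_atm M (Eq t u) \<longleftrightarrow> wf_trm M t \<and> wf_trm M u"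
| "wf_atm M (Rl r ts) \<longleftrightarrow> rel_arity M r = Some (length ts) \<and> (\<forall>t\<in>set ts. wf_trm M t)"

text \<open>Assignments are partial maps; a term or formula is only ever evaluated under
  assignments defined on all its free variables.\<close>

type_synonym 'a assignment = "var \<rightharpoonup> 'a"

primrec trm_val :: "('a, 'f, 'r) fo_struct \<Rightarrow> 'a assignment \<Rightarrow> 'f trm \<Rightarrow> 'a" where
  "trm_val M s (Var x) = the (s x)"
| "trm_val M s (Fn f ts) = fun_int M f (map (trm_val M s) ts)"

primrec atm_sat :: "('a, 'f, 'r) fo_struct \<Rightarrow> 'a assignment \<Rightarrow> ('f, 'r) atm \<Rightarrow> bool" where
  "atm_sat M s (Eq t u) \<longleftrightarrow> trm_val M s t = trm_val M s u"
| "atm_sat M s (Rl r ts) \<longleftrightarrow> map (trm_val M s) ts \<in> rel_int M r"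

datatype ('f, 'r) fo_fm =
    FAtm "('f, 'r) atm"
  | FNeg "('f, 'r) fo_fm"
  | FAnd "('f, 'r) fo_fm" "('f, 'r) fo_fm"
  | FOr "('f, 'r) fo_fm" "('f, 'r) fo_fm"
  | FEx var "('f, 'r) fo_fm"
  | FAll var "('f, 'r) fo_fm"

primrec fo_free :: "('f, 'r) fo_fm \<Rightarrow> var set" where
  "fo_free (FAtm a) = atm_vars a"
| "fo_free (FNeg \<phi>) = fo_free \<phi>"
| "fo_free (FAnd \<phi> \<psi>) = fo_free \<phi> \<union> fo_free \<psi>"
| "fo_free (FOr \<phi> \<psi>) = fo_free \<phi> \<union> fo_free \<psi>"
| "fo_free (FEx x \<phi>) = fo_free \<phi> - {x}"
| "fo_free (FAll x \<phi>) = fo_free \<phi> - {x}"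

primrec wf_fo :: "('a, 'f, 'r) fo_struct \<Rightarrow> ('f, 'r) fo_fm \<Rightarrow> bool" where
  "wf_fo M (FAtm a) \<longleftrightarrow> wf_atm M a"
| "wf_fo M (FNeg \<phi>) \<longleftrightarrow> wf_fo M \<phi>"
| "wf_fo M (FAnd \<phi> \<psi>) \<longleftrightarrow> wf_fo M \<phi> \<and> wf_fo M \<psi>"
| "wf_fo M (FOr \<phi> \<psi>) \<longleftrightarrow> wf_fo M \<phi> \<and> wf_fo M \<psi>"
| "wf_fo M (FEx x \<phi>) \<longleftrightarrow> wf_fo M \<phi>"
| "wf_fo M (FAll x \<phi>) \<longleftrightarrow> wf_fo M \<phi>"

primrec fo_sat :: "('a, 'f, 'r) fo_struct \<Rightarrow> 'a assignment \<Rightarrow> ('f, 'r) fo_fm \<Rightarrow> bool" where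
  "fo_sat M s (FAtm a) \<longleftrightarrow> atm_sat M s a"
| "fo_sat M s (FNeg \<phi>) \<longleftrightarrow> \<not> fo_sat M s \<phi>"
| "fo_sat M s (FAnd \<phi> \<psi>) \<longleftrightarrow> fo_sat M s \<phi> \<and> fo_sat M s \<psi>"
| "fo_sat M s (FOr \<phi> \<psi>) \<longleftrightarrow> fo_sat M s \<phi> \<or> fo_sat M s \<psi>"
| "fo_sat M s (FEx x \<phi>) \<longleftrightarrow> (\<exists>m\<in>Dom M. fo_sat M (s(x \<mapsto> m)) \<phi>)"
| "fo_sat M s (FAll x \<phi>) \<longleftrightarrow> (\<forall>m\<in>Dom M. fo_sat M (s(x \<mapsto> m)) \<phi>)"

section \<open>Teams\<close>

text \<open>The domain is recorded explicitly because the empty set of assignments is a team over every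
  domain.\<close>

datatype 'a team = Team (tdom: "var set") (asgs: "'a assignment set")

definition is_team :: "('a, 'f, 'r) fo_struct \<Rightarrow> 'a team \<Rightarrow> bool" where
  "is_team M X \<longleftrightarrow> finite (tdom X) \<and> (\<forall>s\<in>asgs X. dom s = tdom X \<and> ran s \<subseteq> Dom M)"

text \<open>The variables of the domain are listed in increasing order; any other enumeration yields the
  same definable sets, since a relation symbol may be applied to its arguments in any order.\<close>

definition Rel :: "'a team \<Rightarrow> 'a list set" where
  "Rel X = {map (\<lambda>x. the (s x)) (sorted_list_of_set (tdom X)) |s. s \<in> asgs X}"

definition restrict_team :: "'a team \<Rightarrow> var set \<Rightarrow> 'a team" where
  "restrict_team X V = Team (tdom X \<inter> V) {s |` V |s. s \<in> asgs X}"

definition duplicate :: "('a, 'f, 'r) fo_struct \<Rightarrow> 'a team \<Rightarrow> var \<Rightarrow> 'a team" where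
  "duplicate M X x = Team (insert x (tdom X)) {s(x \<mapsto> m) |s m. s \<in> asgs X \<and> m \<in> Dom M}"

section \<open>General models\<close>

text \<open>First-order formulas with parameters are formulas in the signature of the expansion of \<open>M\<close>
  by a constant \<open>Inr m\<close> for every element \<open>m\<close> of the domain and a relation symbol \<open>Inr X\<close>,
  denoting \<open>Rel X\<close>, for every team \<open>X\<close> in \<open>G\<close>. Each formula mentions only finitely many of them.\<close>

definition expand ::
    "('a, 'f, 'r) fo_struct \<Rightarrow> 'a team set \<Rightarrow> ('a, 'f + 'a, 'r + 'a team) fo_struct" where
  "expand M G =
     \<lparr>Dom = Dom M,
      fun_arity = case_sum (fun_arity M) (\<lambda>m. if m \<in> Dom M then Some 0 else None),
      rel_arity = case_sum (rel_arity M) (\<lambda>X. if X \<in> G then Some (card (tdom X)) else None),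
      fun_int = case_sum (fun_int M) (\<lambda>m _. m),
      rel_int = case_sum (rel_int M) Rel\<rparr>"

definition fo_team :: "('a, 'f, 'r) fo_struct \<Rightarrow> var set \<Rightarrow> ('f, 'r) fo_fm \<Rightarrow> 'a team" where
  "fo_team M V \<phi> = Team V {s. dom s = V \<and> ran s \<subseteq> Dom M \<and> fo_sat M s \<phi>}"

definition general_model :: "('a, 'f, 'r) fo_struct \<Rightarrow> 'a team set \<Rightarrow> bool" where
  "general_model M G \<longleftrightarrow> is_structure M \<and> (\<forall>X\<in>G. is_team M X) \<and>
     (\<forall>\<phi> V. wf_fo (expand M G) \<phi> \<and> finite V \<and> fo_free \<phi> \<subseteq> V \<longrightarrow>
        fo_team (expand M G) V \<phi> \<in> G)"

section \<open>Independence logic\<close>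

text \<open>\<open>Indep t2 t1 t3\<close> is the atom saying that \<open>t2\<close> is independent of \<open>t3\<close> given \<open>t1\<close>.\<close>

datatype ('f, 'r) il_fm =
    Pos "('f, 'r) atm"
  | Neg "('f, 'r) atm"
  | Indep "'f trm list" "'f trm list" "'f trm list"
  | And "('f, 'r) il_fm" "('f, 'r) il_fm"
  | Or "('f, 'r) il_fm" "('f, 'r) il_fm"
  | Ex var "('f, 'r) il_fm"
  | All var "('f, 'r) il_fm"

primrec Free :: "('f, 'r) il_fm \<Rightarrow> var set" where
  "Free (Pos a) = atm_vars a"
| "Free (Neg a) = atm_vars a"
| "Free (Indep t2 t1 t3) = (\<Union>t\<in>set t1 \<union> set t2 \<union> set t3. trm_vars t)"
| "Free (And \<phi> \<psi>) = Free \<phi> \<union> Free \<psi>"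
| "Free (Or \<phi> \<psi>) = Free \<phi> \<union> Free \<psi>"
| "Free (Ex x \<phi>) = Free \<phi> - {x}"
| "Free (All x \<phi>) = Free \<phi> - {x}"

primrec wf_il :: "('a, 'f, 'r) fo_struct \<Rightarrow> ('f, 'r) il_fm \<Rightarrow> bool" where
  "wf_il M (Pos a) \<longleftrightarrow> wf_atm M a"
| "wf_il M (Neg a) \<longleftrightarrow> wf_atm M a"
| "wf_il M (Indep t2 t1 t3) \<longleftrightarrow> (\<forall>t\<in>set t1 \<union> set t2 \<union> set t3. wf_trm M t)"
| "wf_il M (And \<phi> \<psi>) \<longleftrightarrow> wf_il M \<phi> \<and> wf_il M \<psi>"
| "wf_il M (Or \<phi> \<psi>) \<longleftrightarrow> wf_il M \<phi> \<and> wf_il M \<psi>"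
| "wf_il M (Ex x \<phi>) \<longleftrightarrow> wf_il M \<phi>"
| "wf_il M (All x \<phi>) \<longleftrightarrow> wf_il M \<phi>"

primrec team_sat ::
    "('a, 'f, 'r) fo_struct \<Rightarrow> 'a team set \<Rightarrow> 'a team \<Rightarrow> ('f, 'r) il_fm \<Rightarrow> bool" where
  "team_sat M G X (Pos a) \<longleftrightarrow> (\<forall>s\<in>asgs X. atm_sat M s a)"
| "team_sat M G X (Neg a) \<longleftrightarrow> (\<forall>s\<in>asgs X. \<not> atm_sat M s a)"
| "team_sat M G X (Indep t2 t1 t3) \<longleftrightarrow>
     (\<forall>s\<in>asgs X. \<forall>s'\<in>asgs X. map (trm_val M s) t1 = map (trm_val M s') t1 \<longrightarrow>
        (\<exists>s''\<in>asgs X. map (trm_val M s'') (t1 @ t2) = map (trm_val M s) (t1 @ t2) \<and>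
                      map (trm_val M s'') (t1 @ t3) = map (trm_val M s') (t1 @ t3)))"
| "team_sat M G X (And \<phi> \<psi>) \<longleftrightarrow> team_sat M G X \<phi> \<and> team_sat M G X \<psi>"
| "team_sat M G X (Or \<phi> \<psi>) \<longleftrightarrow>
     (\<exists>Y\<in>G. \<exists>Z\<in>G. tdom Y = tdom X \<and> tdom Z = tdom X \<and> asgs X = asgs Y \<union> asgs Z \<and>
        team_sat M G Y \<phi> \<and> team_sat M G Z \<psi>)"
| "team_sat M G X (Ex x \<phi>) \<longleftrightarrow>
     (\<exists>X'\<in>G. tdom X' = tdom X \<union> {x} \<and>
        restrict_team X' (tdom X - {x}) = restrict_team X (tdom X - {x}) \<and>
        team_sat M G X' \<phi>)"
| "team_sat M G X (All x \<phi>) \<longleftrightarrow> team_sat M G (duplicate M X x) \<phi>"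

end

theory Submission
  imports Defs
begin

text \<open>By induction on \<open>\<phi>\<close>, satisfaction is invariant between any two teams of \<open>G\<close> that have the same
  projection to \<open>Free \<phi>\<close>; this symmetric form makes the two directions of the theorem one. For a
  disjunction or an existential quantifier the witnessing teams over \<open>X\<close> are transported to \<open>Y\<close> by
  cutting out those assignments whose projections lie in prescribed projections of teams of \<open>G\<close>.
  Such a team is first-order definable with teams as parameters, hence in \<open>G\<close>: membership in a
  projection is \<open>Rel\<close> with the remaining variables existentially quantified.\<close>

section \<open>Dependence of terms and atoms on their variables\<close>

lemma trm_val_cong:
  "(\<And>v. v \<in> trm_vars t \<Longrightarrow> s v = s' v) \<Longrightarrow> trm_val M s t = trm_val M s' t"
proof (induction t)
  case (Fn f ts)
  then have "map (trm_val M s) ts = map (trm_val M s') ts"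
    by (intro map_cong refl Fn.IH) auto
  then show ?case by (simp del: map_eq_conv)
qed simp

lemma map_trm_val_cong:
  assumes "\<And>v. v \<in> (\<Union>t\<in>set ts. trm_vars t) \<Longrightarrow> s v = s' v"
  shows "map (trm_val M s) ts = map (trm_val M s') ts"
  using assms by (auto intro!: trm_val_cong)

lemma atm_sat_cong:
  assumes "\<And>v. v \<in> atm_vars a \<Longrightarrow> s v = s' v"
  shows "atm_sat M s a \<longleftrightarrow> atm_sat M s' a"
proof (cases a)
  case (Eq t u)
  then show ?thesis
    using assms trm_val_cong[of t s s' M] trm_val_cong[of u s s' M] by simp
next
  case (Rl r ts)
  then show ?thesis
    using assms map_trm_val_cong[of ts s s' M] by (simp del: map_eq_conv)
qed

section \<open>Projections of teams\<close>

definition in_proj :: "var set \<Rightarrow> 'a team \<Rightarrow> 'a assignment \<Rightarrow> bool" where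
  "in_proj V X s \<longleftrightarrow> (\<exists>t\<in>asgs X. \<forall>v\<in>V. s v = t v)"

text \<open>Agreement is required on \<open>V\<close> only, so teams over different domains can be
  compared without forming their restrictions.\<close>

definition same_proj :: "var set \<Rightarrow> 'a team \<Rightarrow> 'a team \<Rightarrow> bool" where
  "same_proj V X Y \<longleftrightarrow> (\<forall>s\<in>asgs X. in_proj V Y s) \<and> (\<forall>s\<in>asgs Y. in_proj V X s)"

lemma same_proj_sym: "same_proj V X Y \<Longrightarrow> same_proj V Y X"
  by (auto simp: same_proj_def)

lemma same_projD:
  assumes "same_proj V X Y" "s \<in> asgs X"
  obtains t where "t \<in> asgs Y" "\<And>v. v \<in> V \<Longrightarrow> s v = t v"
  using assms unfolding same_proj_def in_proj_def by blast

lemma same_proj_mono: "same_proj V X Y \<Longrightarrow> U \<subseteq> V \<Longrightarrow> same_proj U X Y"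
  unfolding same_proj_def in_proj_def by blast

lemma restrict_map_eq_iff: "s |` V = t |` V \<longleftrightarrow> (\<forall>v\<in>V. s v = t v)"
  by (auto simp: restrict_map_def fun_eq_iff)

text \<open>Turns the side condition in the existential clause of \<open>team_sat\<close> into
  \<open>same_proj\<close>. The domains need a separate equation because an empty set of assignments
  does not determine one.\<close>

lemma restrict_team_eq_iff:
  "restrict_team X V = restrict_team Y V \<longleftrightarrow>
     tdom X \<inter> V = tdom Y \<inter> V \<and> same_proj V X Y"
proof -
  have "{s |` V |s. s \<in> asgs X} = {s |` V |s. s \<in> asgs Y} \<longleftrightarrow> same_proj V X Y"
    unfolding same_proj_def in_proj_def restrict_map_eq_iff[symmetric] by blast
  then show ?thesis
    by (simp add: restrict_team_def)
qed

lemma same_proj_restrict_team: "same_proj V X (restrict_team X V)"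
  unfolding same_proj_def in_proj_def restrict_team_def by fastforce

section \<open>Definability of projections in a general model\<close>

context
  fixes M :: "('a, 'f, 'r) fo_struct" and G :: "'a team set"
  assumes general: "general_model M G"
begin

lemma G_finite: "X \<in> G \<Longrightarrow> finite (tdom X)"
  using general by (simp add: general_model_def is_team_def)

lemma G_dom: "X \<in> G \<Longrightarrow> s \<in> asgs X \<Longrightarrow> dom s = tdom X"
  using general by (simp add: general_model_def is_team_def)

lemma G_ran: "X \<in> G \<Longrightarrow> s \<in> asgs X \<Longrightarrow> ran s \<subseteq> Dom M"
  using general by (simp add: general_model_def is_team_def)

lemma Rel_iff:
  assumes X: "X \<in> G" and s: "tdom X \<subseteq> dom s"
  shows "map (\<lambda>v. the (s v)) (sorted_list_of_set (tdom X)) \<in> Rel X \<longleftrightarrow> in_proj (tdom X) X s"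
proof -
  have "map (\<lambda>v. the (s v)) (sorted_list_of_set (tdom X))
          = map (\<lambda>v. the (t v)) (sorted_list_of_set (tdom X)) \<longleftrightarrow> (\<forall>v\<in>tdom X. s v = t v)"
    if t: "t \<in> asgs X" for t
  proof -
    \<comment> \<open>\<open>the\<close> loses no information here, since both assignments are
      defined at \<open>v\<close>.\<close>
    have "the (s v) = the (t v) \<longleftrightarrow> s v = t v" if "v \<in> tdom X" for v
    proof -
      have "v \<in> dom s" "v \<in> dom t"
        using that s G_dom[OF X t] by auto
      then show ?thesis by auto
    qed
    then show ?thesis
      using G_finite[OF X] by simp
  qed
  then show ?thesis
    unfolding Rel_def in_proj_def by blast
qed

text \<open>Dropping a variable from a projection amounts to quantifying it existentially. Writing
  the target set as a difference lets the induction start from the full domain, where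
  \<open>Rel X\<close> itself is the projection, and remove one variable at a time.\<close>

lemma in_proj_definable_Diff:
  assumes X: "X \<in> G" and Z: "finite Z"
  shows "\<exists>\<phi>. wf_fo (expand M G) \<phi> \<and> fo_free \<phi> \<subseteq> tdom X - Z \<and>
           (\<forall>s. tdom X - Z \<subseteq> dom s \<longrightarrow>
              (fo_sat (expand M G) s \<phi> \<longleftrightarrow> in_proj (tdom X - Z) X s))"
  using Z
proof (induction Z rule: finite_induct)
  case empty
  \<comment> \<open>The arguments come in the same increasing order that \<open>Rel\<close>
    uses.\<close>
  let ?\<phi> = "FAtm (Rl (Inr X) (map Var (sorted_list_of_set (tdom X))))
              :: ('f + 'a, 'r + 'a team) fo_fm"
  have "wf_fo (expand M G) ?\<phi>"
    using X by (auto simp: expand_def)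
  moreover have "fo_free ?\<phi> \<subseteq> tdom X"
    using G_finite[OF X] by auto
  moreover have "fo_sat (expand M G) s ?\<phi> \<longleftrightarrow> in_proj (tdom X) X s" if "tdom X \<subseteq> dom s" for s
    using Rel_iff[OF X that] by (simp add: expand_def comp_def)
  ultimately show ?case
    unfolding Diff_empty by (intro exI[of _ ?\<phi>] conjI allI impI)
next
  case (insert z Z)
  then obtain \<phi> where \<phi>: "wf_fo (expand M G) \<phi>" "fo_free \<phi> \<subseteq> tdom X - Z"
    "\<And>s. tdom X - Z \<subseteq> dom s \<Longrightarrow> fo_sat (expand M G) s \<phi> \<longleftrightarrow> in_proj (tdom X - Z) X s"
    by blast
  show ?case
  proof (cases "z \<in> tdom X")
    case False
    then have "tdom X - insert z Z = tdom X - Z" by auto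
    then show ?thesis using \<phi> by auto
  next
    case True
    have "fo_sat (expand M G) s (FEx z \<phi>) \<longleftrightarrow> in_proj (tdom X - insert z Z) X s"
      if s: "tdom X - insert z Z \<subseteq> dom s" for s
    proof -
      \<comment> \<open>\<open>s\<close> may be undefined at \<open>z\<close>; the update supplies
        exactly the variable that the induction hypothesis needs in addition.\<close>
      have "fo_sat (expand M G) (s(z \<mapsto> m)) \<phi> \<longleftrightarrow> in_proj (tdom X - Z) X (s(z \<mapsto> m))" for m
        using s by (intro \<phi>) auto
      then have "fo_sat (expand M G) s (FEx z \<phi>) \<longleftrightarrow>
                   (\<exists>m\<in>Dom M. in_proj (tdom X - Z) X (s(z \<mapsto> m)))"
        by (simp add: expand_def)
      also have "\<dots> \<longleftrightarrow> in_proj (tdom X - insert z Z) X s"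
      proof
        assume "\<exists>m\<in>Dom M. in_proj (tdom X - Z) X (s(z \<mapsto> m))"
        then show "in_proj (tdom X - insert z Z) X s"
          unfolding in_proj_def by (metis Diff_iff fun_upd_other insert_iff)
      next
        assume "in_proj (tdom X - insert z Z) X s"
        then obtain t where t: "t \<in> asgs X" "\<And>v. v \<in> tdom X - insert z Z \<Longrightarrow> s v = t v"
          unfolding in_proj_def by blast
        \<comment> \<open>The quantifier is witnessed by the value at \<open>z\<close> of the
          assignment in \<open>X\<close> that agrees with \<open>s\<close>.\<close>
        obtain m where m: "t z = Some m"
          using True G_dom[OF X t(1)] by blast
        then have "m \<in> Dom M"
          using G_ran[OF X t(1)] ranI by fastforce
        moreover have "in_proj (tdom X - Z) X (s(z \<mapsto> m))"
          unfolding in_proj_def using t m by (intro bexI[of _ t]) auto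
        ultimately show "\<exists>m\<in>Dom M. in_proj (tdom X - Z) X (s(z \<mapsto> m))" by blast
      qed
      finally show ?thesis .
    qed
    moreover have "wf_fo (expand M G) (FEx z \<phi>)" "fo_free (FEx z \<phi>) \<subseteq> tdom X - insert z Z"
      using \<phi> by auto
    ultimately show ?thesis
      by (intro exI[of _ "FEx z \<phi>"] conjI allI impI)
  qed
qed

lemma in_proj_definable:
  assumes "X \<in> G" "V \<subseteq> tdom X"
  obtains \<phi> where "wf_fo (expand M G) \<phi>" "fo_free \<phi> \<subseteq> V"
    "\<And>s. V \<subseteq> dom s \<Longrightarrow> fo_sat (expand M G) s \<phi> \<longleftrightarrow> in_proj V X s"
proof -
  have "tdom X - (tdom X - V) = V" "finite (tdom X - V)"
    using assms G_finite by auto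
  then show thesis
    using in_proj_definable_Diff[OF assms(1), of "tdom X - V"] that by auto
qed

section \<open>Teams cut out by two projections\<close>

text \<open>For \<open>V\<close> and \<open>W\<close> inside \<open>D\<close> this is the natural
  join of two projections, with the remaining variables of \<open>D\<close> ranging freely over
  \<open>Dom M\<close>. Restriction, duplication and both witness constructions below are instances,
  so closure of \<open>G\<close> is proved once.\<close>

definition amalgam :: "var set \<Rightarrow> var set \<Rightarrow> 'a team \<Rightarrow> var set \<Rightarrow> 'a team \<Rightarrow> 'a team" where
  "amalgam D V X W Y =
     Team D {s. dom s = D \<and> ran s \<subseteq> Dom M \<and> in_proj V X s \<and> in_proj W Y s}"

lemma tdom_amalgam [simp]: "tdom (amalgam D V X W Y) = D"
  by (simp add: amalgam_def)

lemma asgs_amalgam: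
  "s \<in> asgs (amalgam D V X W Y) \<longleftrightarrow>
     dom s = D \<and> ran s \<subseteq> Dom M \<and> in_proj V X s \<and> in_proj W Y s"
  by (simp add: amalgam_def)

text \<open>The conjunction of the formulas defining the two projections defines the amalgam. This
  is the only place where closure of \<open>G\<close> under definability is invoked.\<close>

lemma amalgam_in_G:
  assumes "X \<in> G" "Y \<in> G" "finite D" "V \<subseteq> tdom X" "V \<subseteq> D" "W \<subseteq> tdom Y" "W \<subseteq> D"
  shows "amalgam D V X W Y \<in> G"
proof -
  obtain \<phi> where \<phi>: "wf_fo (expand M G) \<phi>" "fo_free \<phi> \<subseteq> V"
    "\<And>s. V \<subseteq> dom s \<Longrightarrow> fo_sat (expand M G) s \<phi> \<longleftrightarrow> in_proj V X s"
    using in_proj_definable assms by blast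
  obtain \<psi> where \<psi>: "wf_fo (expand M G) \<psi>" "fo_free \<psi> \<subseteq> W"
    "\<And>s. W \<subseteq> dom s \<Longrightarrow> fo_sat (expand M G) s \<psi> \<longleftrightarrow> in_proj W Y s"
    using in_proj_definable assms by blast
  have "fo_team (expand M G) D (FAnd \<phi> \<psi>) = amalgam D V X W Y"
    using \<phi>(3) \<psi>(3) assms by (auto simp: fo_team_def amalgam_def expand_def)
  moreover have "wf_fo (expand M G) (FAnd \<phi> \<psi>) \<and> finite D \<and> fo_free (FAnd \<phi> \<psi>) \<subseteq> D"
    using \<phi> \<psi> assms by auto
  ultimately show ?thesis
    using general unfolding general_model_def by metis
qed

lemma restrict_team_in_G:
  assumes X: "X \<in> G" and V: "V \<subseteq> tdom X"
  shows "restrict_team X V \<in> G"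
proof -
  \<comment> \<open>One projection suffices for a restriction, so it is simply imposed
    twice.\<close>
  have "s \<in> asgs (amalgam V V X V X) \<longleftrightarrow> s \<in> asgs (restrict_team X V)" for s
  proof
    assume "s \<in> asgs (amalgam V V X V X)"
    then obtain t where t: "dom s = V" "t \<in> asgs X" "\<And>v. v \<in> V \<Longrightarrow> s v = t v"
      unfolding asgs_amalgam in_proj_def by blast
    then have "s = t |` V"
      by (force simp: restrict_map_def fun_eq_iff)
    then show "s \<in> asgs (restrict_team X V)"
      using t by (auto simp: restrict_team_def)
  next
    assume "s \<in> asgs (restrict_team X V)"
    then obtain t where t: "t \<in> asgs X" "s = t |` V"
      by (auto simp: restrict_team_def)
    have "dom s = V"
      using t V G_dom[OF X t(1)] by auto
    moreover have "ran s \<subseteq> Dom M"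
      using t G_ran[OF X t(1)] by (auto simp: ran_def restrict_map_def split: if_splits)
    moreover have "in_proj V X s"
      unfolding in_proj_def using t by auto
    ultimately show "s \<in> asgs (amalgam V V X V X)"
      by (simp add: asgs_amalgam)
  qed
  moreover have "tdom (restrict_team X V) = V"
    using V by (auto simp: restrict_team_def)
  ultimately have "restrict_team X V = amalgam V V X V X"
    by (intro team.expand) auto
  then show ?thesis
    using amalgam_in_G[OF X X, of V V V] V G_finite[OF X] finite_subset by auto
qed

lemma extend_in_G:
  assumes X: "X \<in> G" and s: "s \<in> asgs X" and m: "m \<in> Dom M"
  shows "dom (s(x \<mapsto> m)) = insert x (tdom X)" "ran (s(x \<mapsto> m)) \<subseteq> Dom M"
  using G_dom[OF X s] G_ran[OF X s] m by (auto simp: ran_def)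

lemma duplicate_in_G:
  assumes X: "X \<in> G"
  shows "duplicate M X x \<in> G"
proof -
  let ?V = "tdom X - {x}"
  \<comment> \<open>The variable \<open>x\<close> belongs to the domain but to neither projection,
    so its value is arbitrary; a value that \<open>X\<close> may already give to \<open>x\<close> is
    forgotten.\<close>
  let ?A = "amalgam (insert x (tdom X)) ?V X ?V X"
  have "s \<in> asgs ?A \<longleftrightarrow> s \<in> asgs (duplicate M X x)" for s
  proof
    assume "s \<in> asgs ?A"
    then obtain t where t: "dom s = insert x (tdom X)" "ran s \<subseteq> Dom M"
      "t \<in> asgs X" "\<And>v. v \<in> ?V \<Longrightarrow> s v = t v"
      unfolding asgs_amalgam in_proj_def by blast
    obtain m where m: "s x = Some m"
      using t(1) by blast
    have "s v = (t(x \<mapsto> m)) v" for v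
    proof (cases "v \<in> insert x (tdom X)")
      case True
      then show ?thesis using t m by auto
    next
      case False
      then have "v \<notin> dom s" "v \<notin> dom t"
        using t(1) G_dom[OF X t(3)] by auto
      then show ?thesis using False by (auto simp: domIff)
    qed
    then have "s = t(x \<mapsto> m)" ..
    moreover have "m \<in> Dom M"
      using t(2) m ranI by fastforce
    ultimately show "s \<in> asgs (duplicate M X x)"
      using t(3) by (auto simp: duplicate_def)
  next
    assume "s \<in> asgs (duplicate M X x)"
    then obtain t m where t: "t \<in> asgs X" "m \<in> Dom M" "s = t(x \<mapsto> m)"
      by (auto simp: duplicate_def)
    moreover have "in_proj ?V X s"
      unfolding in_proj_def using t by auto
    ultimately show "s \<in> asgs ?A"
      using extend_in_G[OF X t(1,2)] by (simp add: asgs_amalgam)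
  qed
  moreover have "tdom (duplicate M X x) = insert x (tdom X)"
    by (simp add: duplicate_def)
  ultimately have "duplicate M X x = ?A"
    by (intro team.expand) auto
  then show ?thesis
    using amalgam_in_G[OF X X, of "insert x (tdom X)" ?V ?V] G_finite[OF X] by auto
qed

text \<open>Duplication offers every element of \<open>Dom M\<close> at \<open>x\<close>, so
  partners that agree off \<open>x\<close> can be given the same value there.\<close>

lemma same_proj_duplicate:
  assumes "same_proj (V - {x}) X Y"
  shows "same_proj V (duplicate M X x) (duplicate M Y x)"
proof -
  have "in_proj V (duplicate M Y x) s"
    if XY: "same_proj (V - {x}) X Y" and "s \<in> asgs (duplicate M X x)" for X Y :: "'a team" and s
  proof -
    obtain s' m where s: "s' \<in> asgs X" "m \<in> Dom M" "s = s'(x \<mapsto> m)"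
      using \<open>s \<in> asgs (duplicate M X x)\<close> by (auto simp: duplicate_def)
    obtain t where t: "t \<in> asgs Y" "\<And>v. v \<in> V - {x} \<Longrightarrow> s' v = t v"
      using same_projD[OF XY s(1)] by blast
    have "t(x \<mapsto> m) \<in> asgs (duplicate M Y x)"
      using s t by (auto simp: duplicate_def)
    then show ?thesis
      unfolding in_proj_def using s t by (intro bexI[of _ "t(x \<mapsto> m)"]) auto
  qed
  from this[OF assms] this[OF same_proj_sym[OF assms]] show ?thesis
    unfolding same_proj_def by blast
qed

section \<open>Transport of witnessing teams\<close>

text \<open>Each part of \<open>Y\<close> consists of the assignments whose
  \<open>V\<close>-projection occurs in the corresponding part of \<open>X\<close>. The parts cover
  \<open>Y\<close> because every assignment in \<open>Y\<close> has a partner in \<open>X\<close>,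
  and they lose no projection because every assignment in \<open>X\<close> has a partner in
  \<open>Y\<close>.\<close>

lemma split_transfer:
  assumes Y: "Y \<in> G" and X1: "X1 \<in> G" and X2: "X2 \<in> G"
    and V: "V \<subseteq> tdom X1" "V \<subseteq> tdom X2" "V \<subseteq> tdom Y"
    and X: "asgs X = asgs X1 \<union> asgs X2" and XY: "same_proj V X Y"
  obtains Y1 Y2 where "Y1 \<in> G" "Y2 \<in> G" "tdom Y1 = tdom Y" "tdom Y2 = tdom Y"
    "asgs Y = asgs Y1 \<union> asgs Y2" "same_proj V X1 Y1" "same_proj V X2 Y2"
proof -
  \<comment> \<open>Projecting \<open>Y\<close> to its whole domain confines the amalgam to members
    of \<open>Y\<close>.\<close>
  let ?A = "\<lambda>Z. amalgam (tdom Y) V Z (tdom Y) Y"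
  have A: "s \<in> asgs (?A Z) \<longleftrightarrow> s \<in> asgs Y \<and> in_proj V Z s" for s Z
  proof
    assume "s \<in> asgs (?A Z)"
    then obtain t where t: "dom s = tdom Y" "in_proj V Z s" "t \<in> asgs Y"
      "\<And>v. v \<in> tdom Y \<Longrightarrow> s v = t v"
      unfolding asgs_amalgam in_proj_def[of "tdom Y"] by blast
    have "s = t"
    proof
      fix v
      show "s v = t v"
        using t(1,4) G_dom[OF Y t(3)] by (metis domIff)
    qed
    then show "s \<in> asgs Y \<and> in_proj V Z s"
      using t by simp
  next
    assume "s \<in> asgs Y \<and> in_proj V Z s"
    moreover from this have "in_proj (tdom Y) Y s"
      unfolding in_proj_def by blast
    ultimately show "s \<in> asgs (?A Z)"
      using G_dom[OF Y] G_ran[OF Y] by (simp add: asgs_amalgam)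
  qed
  have "same_proj V Z (?A Z)" if "asgs Z \<subseteq> asgs X" for Z
  proof -
    have "in_proj V (?A Z) s" if s: "s \<in> asgs Z" for s
    proof -
      obtain t where t: "t \<in> asgs Y" "\<And>v. v \<in> V \<Longrightarrow> s v = t v"
        using same_projD[OF XY] s \<open>asgs Z \<subseteq> asgs X\<close> by blast
      have "in_proj V Z t"
        unfolding in_proj_def using s t(2) by (intro bexI[of _ s]) auto
      with t(1) have "t \<in> asgs (?A Z)"
        by (simp add: A)
      then show ?thesis
        unfolding in_proj_def using t(2) by (intro bexI[of _ t]) auto
    qed
    then show ?thesis
      by (simp add: same_proj_def A)
  qed
  then have "same_proj V X1 (?A X1)" "same_proj V X2 (?A X2)"
    using X by auto
  moreover have "asgs Y = asgs (?A X1) \<union> asgs (?A X2)"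
  proof -
    have "in_proj V X1 s \<or> in_proj V X2 s" if s: "s \<in> asgs Y" for s
    proof -
      obtain t where "t \<in> asgs X" "\<And>v. v \<in> V \<Longrightarrow> s v = t v"
        using same_projD[OF same_proj_sym[OF XY] s] by blast
      then show ?thesis
        using X unfolding in_proj_def by auto
    qed
    then show ?thesis
      by (simp add: set_eq_iff A) blast
  qed
  moreover have "?A X1 \<in> G" "?A X2 \<in> G"
    using amalgam_in_G[OF X1 Y] amalgam_in_G[OF X2 Y] V G_finite[OF Y] by auto
  ultimately show thesis
    using that by simp
qed

text \<open>The new team takes its values on \<open>V\<close> and at \<open>x\<close> jointly from
  \<open>X'\<close> and its values off \<open>x\<close> from \<open>Y\<close>. The two demands
  overlap only on \<open>V - {x}\<close>, where \<open>X'\<close> and \<open>Y\<close> have the same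
  projection because both agree there with \<open>X\<close>.\<close>

lemma extension_transfer:
  assumes X: "X \<in> G" and Y: "Y \<in> G" and X': "X' \<in> G"
    and V: "V - {x} \<subseteq> tdom X" "V - {x} \<subseteq> tdom Y" and XY: "same_proj (V - {x}) X Y"
    and dom: "tdom X' = tdom X \<union> {x}" and XX': "same_proj (tdom X - {x}) X' X"
  obtains Y' where "Y' \<in> G" "tdom Y' = tdom Y \<union> {x}" "same_proj (tdom Y - {x}) Y' Y"
    "same_proj V X' Y'"
proof -
  let ?D = "tdom Y \<union> {x}"
  let ?Y' = "amalgam ?D (insert x V) X' (tdom Y - {x}) Y"
  \<comment> \<open>Gluing: any \<open>s'\<close> and \<open>t\<close> that agree on the overlap
    combine into a member of the new team.\<close>
  have key: "t(x := s' x) \<in> asgs ?Y'"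
    if s': "s' \<in> asgs X'" and t: "t \<in> asgs Y" and st: "\<And>v. v \<in> V - {x} \<Longrightarrow> s' v = t v" for s' t
  proof -
    obtain m where m: "s' x = Some m"
      using G_dom[OF X' s'] dom by blast
    then have "m \<in> Dom M"
      using G_ran[OF X' s'] ranI by fastforce
    from extend_in_G[OF Y t this, of x]
    have "dom (t(x := s' x)) = ?D" "ran (t(x := s' x)) \<subseteq> Dom M"
      using m by auto
    moreover have "in_proj (insert x V) X' (t(x := s' x))"
      unfolding in_proj_def using s' st by (intro bexI[of _ s']) auto
    moreover have "in_proj (tdom Y - {x}) Y (t(x := s' x))"
      unfolding in_proj_def using t by (intro bexI[of _ t]) auto
    ultimately show ?thesis
      by (simp add: asgs_amalgam)
  qed
  have "in_proj (tdom Y - {x}) ?Y' t" if t: "t \<in> asgs Y" for t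
  proof -
    \<comment> \<open>A partner for \<open>t\<close> is found in \<open>X'\<close> by way of
      \<open>X\<close>. Below, the same route is taken backwards from \<open>X'\<close> to
      \<open>Y\<close>.\<close>
    obtain s where s: "s \<in> asgs X" "\<And>v. v \<in> V - {x} \<Longrightarrow> t v = s v"
      using same_projD[OF same_proj_sym[OF XY] t] by blast
    obtain s' where s': "s' \<in> asgs X'" "\<And>v. v \<in> tdom X - {x} \<Longrightarrow> s v = s' v"
      using same_projD[OF same_proj_sym[OF XX'] s(1)] by blast
    have "s' v = t v" if "v \<in> V - {x}" for v
      using V(1) s(2) s'(2) that by (metis Diff_iff subsetD)
    then have "t(x := s' x) \<in> asgs ?Y'"
      by (intro key s'(1) t)
    then show ?thesis
      unfolding in_proj_def[of _ ?Y'] by (intro bexI[of _ "t(x := s' x)"]) auto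
  qed
  then have "same_proj (tdom Y - {x}) ?Y' Y"
    by (simp add: same_proj_def asgs_amalgam)
  moreover have "same_proj V X' ?Y'"
  proof -
    have "in_proj V ?Y' s'" if s': "s' \<in> asgs X'" for s'
    proof -
      obtain s where s: "s \<in> asgs X" "\<And>v. v \<in> tdom X - {x} \<Longrightarrow> s' v = s v"
        using same_projD[OF XX' s'] by blast
      obtain t where t: "t \<in> asgs Y" "\<And>v. v \<in> V - {x} \<Longrightarrow> s v = t v"
        using same_projD[OF XY s(1)] by blast
      have st: "s' v = t v" if "v \<in> V - {x}" for v
        using V(1) s(2) t(2) that by (metis Diff_iff subsetD)
      then have "t(x := s' x) \<in> asgs ?Y'"
        by (intro key s' t(1))
      then show ?thesis
        unfolding in_proj_def[of _ ?Y'] using st by (intro bexI[of _ "t(x := s' x)"]) auto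
    qed
    moreover have "in_proj V X' t" if "t \<in> asgs ?Y'" for t
      using that unfolding asgs_amalgam in_proj_def by blast
    ultimately show ?thesis
      unfolding same_proj_def by blast
  qed
  moreover have "?Y' \<in> G"
    using V dom G_finite[OF Y] by (intro amalgam_in_G X' Y) auto
  ultimately show thesis
    using that[of ?Y'] by simp
qed

section \<open>Invariance of satisfaction under equal projections\<close>

text \<open>One implication suffices because the hypotheses on \<open>X\<close> and \<open>Y\<close>
  are symmetric. Both teams vary in the induction, since \<open>Or\<close>, \<open>Ex\<close> and
  \<open>All\<close> pass to other teams.\<close>

lemma team_sat_same_proj:
  assumes "X \<in> G" "Y \<in> G" "Free \<phi> \<subseteq> tdom X" "Free \<phi> \<subseteq> tdom Y" "same_proj (Free \<phi>) X Y"
    and "team_sat M G X \<phi>"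
  shows "team_sat M G Y \<phi>"
  using assms
proof (induction \<phi> arbitrary: X Y)
  case (Pos a)
  have "atm_sat M t a" if t: "t \<in> asgs Y" for t
  proof -
    obtain s where "s \<in> asgs X" "\<And>v. v \<in> atm_vars a \<Longrightarrow> t v = s v"
      using same_projD[OF same_proj_sym[OF Pos.prems(5)] t] by auto
    then show ?thesis
      using Pos.prems(6) atm_sat_cong[of a t s M] by auto
  qed
  then show ?case by simp
next
  case (Neg a)
  have "\<not> atm_sat M t a" if t: "t \<in> asgs Y" for t
  proof -
    obtain s where "s \<in> asgs X" "\<And>v. v \<in> atm_vars a \<Longrightarrow> t v = s v"
      using same_projD[OF same_proj_sym[OF Neg.prems(5)] t] by auto
    then show ?thesis
      using Neg.prems(6) atm_sat_cong[of a t s M] by auto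
  qed
  then show ?case by simp
next
  case (Indep t2 t1 t3)
  define V where "V = Free (Indep t2 t1 t3)"
  have XY: "same_proj V X Y" and YX: "same_proj V Y X"
    using Indep.prems(5) same_proj_sym[OF Indep.prems(5)] unfolding V_def by simp_all
  have val: "map (trm_val M s) ts = map (trm_val M t) ts"
    if "\<And>v. v \<in> V \<Longrightarrow> s v = t v" "set ts \<subseteq> set t1 \<union> set t2 \<union> set t3" for s t ts
  proof (rule map_trm_val_cong)
    have "(\<Union>t\<in>set ts. trm_vars t) \<subseteq> V"
      using that(2) unfolding V_def by auto
    then show "s v = t v" if "v \<in> (\<Union>t\<in>set ts. trm_vars t)" for v
      using \<open>\<And>v. v \<in> V \<Longrightarrow> s v = t v\<close>[OF subsetD[OF _ that]] by simp
  qed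
  have "\<exists>t''\<in>asgs Y. map (trm_val M t'') (t1 @ t2) = map (trm_val M t) (t1 @ t2) \<and>
                     map (trm_val M t'') (t1 @ t3) = map (trm_val M t') (t1 @ t3)"
    if t: "t \<in> asgs Y" "t' \<in> asgs Y" "map (trm_val M t) t1 = map (trm_val M t') t1" for t t'
  proof -
    \<comment> \<open>Both assignments are pulled back to \<open>X\<close>, the atom is applied
      there, and the resulting \<open>s''\<close> is pushed forward to \<open>Y\<close>.\<close>
    obtain s where s: "s \<in> asgs X" "\<And>v. v \<in> V \<Longrightarrow> t v = s v"
      using same_projD[OF YX t(1)] by blast
    obtain s' where s': "s' \<in> asgs X" "\<And>v. v \<in> V \<Longrightarrow> t' v = s' v"
      using same_projD[OF YX t(2)] by blast
    have eq: "map (trm_val M s) t1 = map (trm_val M s') t1"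
      by (rule trans[OF trans[OF val[OF s(2), symmetric] t(3)] val[OF s'(2)]]) auto
    obtain s'' where s'': "s'' \<in> asgs X"
      "map (trm_val M s'') (t1 @ t2) = map (trm_val M s) (t1 @ t2)"
      "map (trm_val M s'') (t1 @ t3) = map (trm_val M s') (t1 @ t3)"
      using Indep.prems(6)[unfolded team_sat.simps, rule_format, OF s(1) s'(1) eq] by blast
    obtain t'' where t'': "t'' \<in> asgs Y" "\<And>v. v \<in> V \<Longrightarrow> s'' v = t'' v"
      using same_projD[OF XY s''(1)] by blast
    have "map (trm_val M t'') (t1 @ t2) = map (trm_val M t) (t1 @ t2)"
      by (rule trans[OF trans[OF val[OF t''(2), symmetric] s''(2)] val[OF s(2), symmetric]])
        auto
    moreover have "map (trm_val M t'') (t1 @ t3) = map (trm_val M t') (t1 @ t3)"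
      by (rule trans[OF trans[OF val[OF t''(2), symmetric] s''(3)] val[OF s'(2), symmetric]])
        auto
    ultimately show ?thesis
      using t''(1) by (intro bexI[of _ t''] conjI)
  qed
  then show ?case
    unfolding team_sat.simps by (intro ballI impI)
next
  case (And \<phi> \<psi>)
  have "same_proj (Free \<phi>) X Y" "same_proj (Free \<psi>) X Y"
    by (rule same_proj_mono[OF And.prems(5)], simp)+
  then show ?case
    using And.prems And.IH(1)[of X Y] And.IH(2)[of X Y] by auto
next
  case (Or \<phi> \<psi>)
  from Or.prems(6) obtain X1 X2 where X12: "X1 \<in> G" "X2 \<in> G"
    "tdom X1 = tdom X" "tdom X2 = tdom X" "asgs X = asgs X1 \<union> asgs X2"
    "team_sat M G X1 \<phi>" "team_sat M G X2 \<psi>"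
    by auto
  \<comment> \<open>The split is transported over the free variables of the whole disjunction, which
    is where \<open>X\<close> and \<open>Y\<close> are known to match; afterwards each projection is
    narrowed to its own disjunct.\<close>
  have "Free (Or \<phi> \<psi>) \<subseteq> tdom X1" "Free (Or \<phi> \<psi>) \<subseteq> tdom X2"
    using X12 Or.prems by auto
  from split_transfer[OF Or.prems(2) X12(1,2) this Or.prems(4) X12(5) Or.prems(5)]
  obtain Y1 Y2 where Y12: "Y1 \<in> G" "Y2 \<in> G" "tdom Y1 = tdom Y" "tdom Y2 = tdom Y"
    "asgs Y = asgs Y1 \<union> asgs Y2"
    and proj: "same_proj (Free (Or \<phi> \<psi>)) X1 Y1" "same_proj (Free (Or \<phi> \<psi>)) X2 Y2"
    by blast
  have "same_proj (Free \<phi>) X1 Y1" "same_proj (Free \<psi>) X2 Y2"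
    by (rule same_proj_mono[OF proj(1)], simp) (rule same_proj_mono[OF proj(2)], simp)
  then have "team_sat M G Y1 \<phi>" "team_sat M G Y2 \<psi>"
    using Or.IH(1)[of X1 Y1] Or.IH(2)[of X2 Y2] X12 Y12 Or.prems by auto
  then show ?case
    using Y12 by auto
next
  case (Ex x \<phi>)
  from Ex.prems(6) obtain X' where X': "X' \<in> G" "tdom X' = tdom X \<union> {x}"
    "same_proj (tdom X - {x}) X' X" "team_sat M G X' \<phi>"
    by (auto simp: restrict_team_eq_iff)
  have V: "Free \<phi> - {x} \<subseteq> tdom X" "Free \<phi> - {x} \<subseteq> tdom Y" "same_proj (Free \<phi> - {x}) X Y"
    using Ex.prems by auto
  \<comment> \<open>Used with \<open>Free \<phi>\<close> as \<open>V\<close>: the given teams match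
    off \<open>x\<close>, and the extended ones match on all of \<open>Free \<phi>\<close>.\<close>
  from extension_transfer[OF Ex.prems(1,2) X'(1) V X'(2,3)]
  obtain Y' where Y': "Y' \<in> G" "tdom Y' = tdom Y \<union> {x}" "same_proj (tdom Y - {x}) Y' Y"
    "same_proj (Free \<phi>) X' Y'"
    by blast
  have "team_sat M G Y' \<phi>"
    using X' Y' V by (intro Ex.IH[of X' Y']) auto
  moreover have "restrict_team Y' (tdom Y - {x}) = restrict_team Y (tdom Y - {x})"
    using Y' by (auto simp: restrict_team_eq_iff)
  ultimately show ?case
    using Y' by auto
next
  case (All x \<phi>)
  have "team_sat M G (duplicate M Y x) \<phi>"
  proof (rule All.IH[of "duplicate M X x" "duplicate M Y x"])
    show "same_proj (Free \<phi>) (duplicate M X x) (duplicate M Y x)"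
      using All.prems by (intro same_proj_duplicate) simp
  qed (use All.prems duplicate_in_G in \<open>auto simp: duplicate_def\<close>)
  then show ?case by simp
qed

end

theorem mainTheorem6:
  fixes M :: "('a, 'f, 'r) fo_struct"
    and G :: "'a team set"
    and X :: "'a team"
    and \<phi> :: "('f, 'r) il_fm"
  assumes "general_model M G"
    and "X \<in> G"
    and "wf_il M \<phi>"
    and "Free \<phi> \<subseteq> tdom X"
  shows "team_sat M G X \<phi> \<longleftrightarrow> team_sat M G (restrict_team X (Free \<phi>)) \<phi>"
proof -
  let ?Y = "restrict_team X (Free \<phi>)"
  have "?Y \<in> G"
    using restrict_team_in_G assms by blast
  moreover have "Free \<phi> \<subseteq> tdom ?Y"
    using assms by (auto simp: restrict_team_def)
  moreover have "same_proj (Free \<phi>) X ?Y"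
    by (rule same_proj_restrict_team)
  ultimately show ?thesis
    using team_sat_same_proj same_proj_sym assms by metis
qed

end
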